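(* Let $\nabla\mathcal F_k$ be the MICE gradient estimator at iteration $k$ with index set $\mathcal L_k$ and sample sizes $\{M_{\ell,k}\}_{\ell\in\mathcal L_k}$ (see context), for the minimization of $F(\boldsymbol\xi)=\mathbb E[f(\boldsymbol\xi,\boldsymbol\theta)]$. Let $(\mathcal E_k)^2=\mathbb E\big[\|\nabla\mathcal F_k-\nabla F(\boldsymbol\xi_k)\|^2\,\big|\,\{\boldsymbol\xi_{\ell'}\}_{\ell'\in\mathcal L_k}\big]$. Then $$\mathbb E\big[(\mathcal E_k)^2\big]=\mathbb E\left[\sum_{\ell\in\mathcal L_k}\frac{V_{\ell,k}}{M_{\ell,k}}\right].$$
   Context: $\boldsymbol\theta\sim\pi$ is a random vector whose law $\pi$ does not depend on $\boldsymbol\xi\in\mathbb R^d$; $\nabla F(\boldsymbol\xi)=\mathbb E[\nabla_{\boldsymbol\xi}f(\boldsymbol\xi,\boldsymbol\theta)]$; all gradients involved are square integrable. Index sets: $\mathcal L_0=\{0\}$ and $k\in\mathcal L_k\subset\mathcal L_{k-1}\cup\{k\}\subset\{0,\dots,k\}$. For $\ell\in\mathcal L_k$, $\ell>\min\mathcal L_k$, let $p_k(\ell)=\max\{\ell'\in\mathcal L_k:\ell'<\ell\}$. Set $$\Delta_{\ell,k}(\boldsymbol\theta)=\begin{cases}\nabla_{\boldsymbol\xi} f(\boldsymbol\xi_\ell,\boldsymbol\theta)-\nabla_{\boldsymbol\xi} f(\boldsymbol\xi_{p_k(\ell)},\boldsymbol\theta),&\ell>\min\mathcal L_k,\\ \nabla_{\boldsymbol\xi}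 f(\boldsymbol\xi_\ell,\boldsymbol\theta),&\ell=\min\mathcal L_k.\end{cases}$$ Given index sets $\mathcal L_k$ and positive integers $M_{\ell,k}$ (with $M_{\ell,k}\ge M_{\ell,k-1}$ for $\ell\in\mathcal L_k\cap\mathcal L_{k-1}$), the MICE estimator is $$\nabla\mathcal F_k=\sum_{\ell\in\mathcal L_k}\hat{\boldsymbol\mu}_{\ell,k},\qquad\hat{\boldsymbol\mu}_{\ell,k}=\frac1{M_{\ell,k}}\sum_{\alpha\in\mathcal I_{\ell,k}}\Delta_{\ell,k}(\boldsymbol\theta_\alpha),$$ where $\mathcal I_{\ell,k}$ indexes the first $M_{\ell,k}$ elements of a sequence of i.i.d. samples from $\pi$ attached to level $\ell$; the sequences of different levels are independent of each other and of $\boldsymbol\xi_0$. Samples are cumulative ($\mathcal I_{\ell,k-1}\subset\mathcal I_{\ell,k}$). The iterate $\boldsymbol\xi_{k+1}$ is produced by a first-order optimizer and is a deterministic function of $\boldsymbol\xi_0$ and the samples used at iterations $0,\dots,k$; level-$\ell$ samples are first used at iteration $\ell$. $V_{\ell,k}$ is the sum over the $d$ components of the conditional variances of $\Delta_{\ell,k}(\boldsymbol\theta)$ given the iterates, for $\boldsymbol\theta\sim\pi$ independent of the iterates: $V_{\ell,k}=\sum_{i=1}^d\mathbb V[\Delta^{(i)}_{\ell,k}\mid\{\boldsymbol\xi_{\ell'}\}_{\ell'\in\mathcal L_k}]$. *)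

theory Defs
  imports "HOL-Probability.Probability"
begin

definition gradient :: "('a::real_inner \<Rightarrow> real) \<Rightarrow> 'a \<Rightarrow> 'a" where
  "gradient g x = (THE D. GDERIV g x :> D)"

lemma gradient_eqI:
  assumes "GDERIV g x :> D"
  shows "gradient g x = D"
  unfolding gradient_def
proof (rule the_equality, rule assms)
  fix D' assume "GDERIV g x :> D'"
  then have "(\<lambda>h. inner h D') = (\<lambda>h. inner h D)"
    using assms unfolding gderiv_def by (rule has_derivative_unique)
  then show "D' = D"
    by (metis vector_eq_ldot)
qed

text \<open>Independence of two random variables whose value types may differ; \<open>indep_var\<close> of the
  library requires them to be equal.\<close>

definition (in prob_space) indep_rv ::
  "'b measure \<Rightarrow> ('a \<Rightarrow> 'b) \<Rightarrow> 'c measure \<Rightarrow> ('a \<Rightarrow> 'c) \<Rightarrow> bool" where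
  "indep_rv S X T Y \<longleftrightarrow>
     random_variable S X \<and> random_variable T Y \<and>
     indep_set {X -` A \<inter> space M | A. A \<in> sets S} {Y -` A \<inter> space M | A. A \<in> sets T}"

lemma (in prob_space) indep_rv_iff_indep_var: "indep_rv S X T Y \<longleftrightarrow> indep_var S X T Y"
proof -
  have *: "(\<lambda>i. {case_bool X Y i -` A \<inter> space M | A. A \<in> sets (case_bool S T i)}) =
      case_bool {X -` A \<inter> space M | A. A \<in> sets S} {Y -` A \<inter> space M | A. A \<in> sets T}"
    by (rule ext) (simp split: bool.split)
  show ?thesis
    unfolding indep_rv_def indep_var_def indep_vars_def2 indep_set_def * by (simp add: UNIV_bool conj_ac ex_bool_eq)
qed

abbreviation grad_f :: "('a::real_inner \<Rightarrow> 'b \<Rightarrow> real) \<Rightarrow> 'a \<Rightarrow> 'b \<Rightarrow> 'a" where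
  "grad_f f x t \<equiv> gradient (\<lambda>y. f y t) x"

definition objective :: "('a \<Rightarrow> 'b \<Rightarrow> real) \<Rightarrow> 'b measure \<Rightarrow> 'a \<Rightarrow> real" where
  "objective f \<pi> x = (\<integral>t. f x t \<partial>\<pi>)"

definition prev_level :: "(nat \<Rightarrow> nat set) \<Rightarrow> nat \<Rightarrow> nat \<Rightarrow> nat" where
  "prev_level L k l = Max {l' \<in> L k. l' < l}"

text \<open>The argument \<open>x\<close> is one trajectory of iterates: \<open>x l\<close> is the value of the \<open>l\<close>-th iterate.\<close>

definition level_diff ::
  "('a::real_inner \<Rightarrow> 'b \<Rightarrow> real) \<Rightarrow> (nat \<Rightarrow> nat set) \<Rightarrow> (nat \<Rightarrow> 'a) \<Rightarrow> nat \<Rightarrow> nat \<Rightarrow> 'b \<Rightarrow> 'a"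
where
  "level_diff f L x l k t =
     (if l > Min (L k) then grad_f f (x l) t - grad_f f (x (prev_level L k l)) t
      else grad_f f (x l) t)"

text \<open>\<open>N l k\<close> is the number of samples of level \<open>l\<close> at iteration \<open>k\<close>, and \<open>\<theta> l \<alpha>\<close> is the
  sample number \<open>\<alpha>\<close> (counted from 0) of the sequence attached to level \<open>l\<close>.\<close>

definition mice_estimator ::
  "('a::real_inner \<Rightarrow> 'b \<Rightarrow> real) \<Rightarrow> (nat \<Rightarrow> nat set) \<Rightarrow> (nat \<Rightarrow> nat \<Rightarrow> nat) \<Rightarrow>
   (nat \<Rightarrow> nat \<Rightarrow> 'w \<Rightarrow> 'b) \<Rightarrow> (nat \<Rightarrow> 'w \<Rightarrow> 'a) \<Rightarrow> nat \<Rightarrow> 'w \<Rightarrow> 'a"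
where
  "mice_estimator f L N \<theta> \<xi> k \<omega> =
     (\<Sum>l\<in>L k. (1 / real (N l k)) *\<^sub>R
        (\<Sum>\<alpha><N l k. level_diff f L (\<lambda>j. \<xi> j \<omega>) l k (\<theta> l \<alpha> \<omega>)))"

definition used_samples ::
  "(nat \<Rightarrow> nat set) \<Rightarrow> (nat \<Rightarrow> nat \<Rightarrow> nat) \<Rightarrow> nat \<Rightarrow> (nat \<times> nat) set" where
  "used_samples L N k = {(l, \<alpha>). \<exists>j\<le>k. l \<in> L j \<and> \<alpha> < N l j}"

text \<open>The sigma-algebra generated by the iterates with index in \<open>L k\<close>.\<close>

definition iterates_algebra ::
  "'w measure \<Rightarrow> (nat \<Rightarrow> nat set) \<Rightarrow> (nat \<Rightarrow> 'w \<Rightarrow> 'a::topological_space) \<Rightarrow> nat \<Rightarrow> 'w measure"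
where
  "iterates_algebra M L \<xi> k =
     vimage_algebra (space M) (\<lambda>\<omega>. \<lambda>j\<in>L k. \<xi> j \<omega>) (\<Pi>\<^sub>M j\<in>L k. borel)"

definition real_cond_var :: "'w measure \<Rightarrow> 'w measure \<Rightarrow> ('w \<Rightarrow> real) \<Rightarrow> 'w \<Rightarrow> real" where
  "real_cond_var M G X =
     real_cond_exp M G (\<lambda>\<omega>. (X \<omega> - real_cond_exp M G X \<omega>)\<^sup>2)"

text \<open>\<open>\<tau>\<close> plays the role of a generic sample, independent of the iterates; it is not one of
  the samples entering the estimator unless chosen so.\<close>

definition level_var ::
  "'w measure \<Rightarrow> (real^'d \<Rightarrow> 'b \<Rightarrow> real) \<Rightarrow> (nat \<Rightarrow> nat set) \<Rightarrow> (nat \<Rightarrow> 'w \<Rightarrow> real^'d) \<Rightarrow>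
   ('w \<Rightarrow> 'b) \<Rightarrow> nat \<Rightarrow> nat \<Rightarrow> 'w \<Rightarrow> real"
where
  "level_var M f L \<xi> \<tau> l k \<omega> =
     (\<Sum>i\<in>UNIV. real_cond_var M (iterates_algebra M L \<xi> k)
        (\<lambda>\<omega>'. level_diff f L (\<lambda>j. \<xi> j \<omega>') l k (\<tau> \<omega>') $ i) \<omega>)"

text \<open>The squared error, itself a random variable.\<close>

definition mice_sq_error ::
  "'w measure \<Rightarrow> 'b measure \<Rightarrow> (real^'d \<Rightarrow> 'b \<Rightarrow> real) \<Rightarrow> (nat \<Rightarrow> nat set) \<Rightarrow>
   (nat \<Rightarrow> nat \<Rightarrow> nat) \<Rightarrow> (nat \<Rightarrow> nat \<Rightarrow> 'w \<Rightarrow> 'b) \<Rightarrow> (nat \<Rightarrow> 'w \<Rightarrow> real^'d) \<Rightarrow> nat \<Rightarrow> 'w \<Rightarrow> real"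
where
  "mice_sq_error M \<pi> f L N \<theta> \<xi> k =
     real_cond_exp M (iterates_algebra M L \<xi> k)
       (\<lambda>\<omega>. (norm (mice_estimator f L N \<theta> \<xi> k \<omega> - gradient (objective f \<pi>) (\<xi> k \<omega>)))\<^sup>2)"

text \<open>The index sets \<open>L\<close> and sample sizes \<open>N\<close> are deterministic. The assumptions
  \<open>iid_level\<close> and \<open>indep_levels\<close> together with \<open>indep_init\<close> say that the initial iterate and all
  samples, over all levels, are mutually independent. In \<open>iterate_Suc\<close> the next iterate is a
  measurable function of the initial iterate and of the samples used so far.\<close>

locale mice = prob_space M
  for M :: "'w measure"
    and \<pi> :: "(real^'m) measure"
    and f :: "real^'d \<Rightarrow> real^'m \<Rightarrow> real"
    and L :: "nat \<Rightarrow> nat set"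
    and N :: "nat \<Rightarrow> nat \<Rightarrow> nat"
    and \<theta> :: "nat \<Rightarrow> nat \<Rightarrow> 'w \<Rightarrow> real^'m"
    and \<xi> :: "nat \<Rightarrow> 'w \<Rightarrow> real^'d" +
  assumes f_integrable: "\<And>x. integrable \<pi> (f x)"
    and f_differentiable: "\<And>x t. (\<lambda>y. f y t) differentiable at x"
    and grad_f_measurable: "(\<lambda>(x, t). grad_f f x t) \<in> borel_measurable (borel \<Otimes>\<^sub>M borel)"
    and grad_f_integrable: "\<And>x. integrable \<pi> (grad_f f x)"
    and objective_differentiable: "\<And>x. objective f \<pi> differentiable at x"
    and gradient_objective: "\<And>x. gradient (objective f \<pi>) x = (\<integral>t. grad_f f x t \<partial>\<pi>)"
    and L_0: "L 0 = {0}"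
    and L_self: "\<And>k. k \<in> L k"
    and L_Suc: "\<And>k. L (Suc k) \<subseteq> L k \<union> {Suc k}"
    and N_pos: "\<And>k l. l \<in> L k \<Longrightarrow> N l k > 0"
    and N_mono: "\<And>k l. l \<in> L (Suc k) \<inter> L k \<Longrightarrow> N l k \<le> N l (Suc k)"
    and sample_law: "\<And>l \<alpha>. distr M borel (\<theta> l \<alpha>) = \<pi>"
    and iid_level: "\<And>l. indep_vars (\<lambda>_. borel) (\<theta> l) UNIV"
    and indep_levels: "indep_vars (\<lambda>_. \<Pi>\<^sub>M \<alpha>\<in>UNIV. borel) (\<lambda>l \<omega> \<alpha>. \<theta> l \<alpha> \<omega>) UNIV"
    and indep_init: "indep_rv borel (\<xi> 0) (\<Pi>\<^sub>M l\<in>UNIV. \<Pi>\<^sub>M \<alpha>\<in>UNIV. borel) (\<lambda>\<omega> l \<alpha>. \<theta> l \<alpha> \<omega>)"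
    and iterate_Suc: "\<And>k. \<exists>\<Phi> \<in> (borel \<Otimes>\<^sub>M (\<Pi>\<^sub>M p\<in>used_samples L N k. borel)) \<rightarrow>\<^sub>M borel.
       \<forall>\<omega>\<in>space M. \<xi> (Suc k) \<omega> = \<Phi> (\<xi> 0 \<omega>, \<lambda>p\<in>used_samples L N k. \<theta> (fst p) (snd p) \<omega>)"

end

theory Submission
  imports Defs
begin

text \<open>
  Write \<open>\<Delta>\<^sub>l\<close> for the level difference, \<open>m\<^sub>l\<close> for its mean over a sample drawn from \<open>\<pi>\<close>
  with the iterates held fixed, and \<open>D\<^sub>l = \<Delta>\<^sub>l - m\<^sub>l\<close>. Taking the expectation removes the
  conditioning in the squared error, so the claim is about the mean square of
  \<open>\<nabla>\<F>\<^sub>k - \<nabla>F(\<xi>\<^sub>k)\<close>. The means telescope along the levels to \<open>\<nabla>F(\<xi>\<^sub>k)\<close>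
  (\<open>sum_mean_diff\<close>), hence that error is a weighted sum of the deviations \<open>D\<^sub>l(\<theta>\<^sub>l\<^sub>\<alpha>)\<close>
  over all samples in use, with weight \<open>1/N\<close> on a level with \<open>N\<close> samples (\<open>estimator_error\<close>).

  These deviations are orthogonal in mean. Given the iterates in \<open>L k\<close> the samples need be neither
  independent nor distributed as \<open>\<pi>\<close>, because the later iterates depend on the samples of the earlier
  levels. Instead each sample is compared with everything else: \<open>\<theta>\<^sub>l\<^sub>\<alpha>\<close> is independent of the initial iterate and
  all other samples together (\<open>sample_indep_others\<close>). The difference \<open>\<Delta>\<^sub>l\<close> involves only
  iterates with index at most \<open>l\<close>, which are computed from samples of levels below \<open>l\<close>. So all
  iterates in \<open>\<Delta>\<^sub>l\<close>, and every deviation of a level at most \<open>l\<close> other than the one of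
  \<open>\<theta>\<^sub>l\<^sub>\<alpha>\<close> itself, are functions of the rest; integrating out \<open>\<theta>\<^sub>l\<^sub>\<alpha>\<close> by Fubini kills
  the product (\<open>centred_diff_sample_orthogonal\<close>). For two given samples this applies to the one of
  the higher level, or to either one if they share a level.

  By Pythagoras (\<open>integral_norm_sum_orthogonal\<close>) the mean square error is the sum over the levels of
  \<open>E|D\<^sub>l|\<^sup>2 / N\<close>. The second moment \<open>E|D\<^sub>l|\<^sup>2\<close> is the same for a sample of the
  estimator and for the generic sample \<open>\<tau>\<close>, both being independent of the iterates in
  \<open>\<Delta>\<^sub>l\<close> and distributed as \<open>\<pi>\<close>; and for \<open>\<tau>\<close> the conditional mean of \<open>\<Delta>\<^sub>l\<close> given the
  iterates is \<open>m\<^sub>l\<close>, so that \<open>E|D\<^sub>l|\<^sup>2\<close> is the expectation of the level variance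
  (\<open>integral_level_var\<close>).
\<close>

section \<open>Independence and integration over frozen variables\<close>

context prob_space
begin

lemma indep_rvI:
  assumes [measurable]: "random_variable S X" "random_variable T Y"
    and "\<And>A B. A \<in> sets S \<Longrightarrow> B \<in> sets T \<Longrightarrow>
      prob (X -` A \<inter> space M \<inter> (Y -` B \<inter> space M)) = prob (X -` A \<inter> space M) * prob (Y -` B \<inter> space M)"
  shows "indep_rv S X T Y"
  unfolding indep_rv_def
  by (intro conjI assms indep_setI) (use assms(3) in \<open>auto intro!: measurable_sets\<close>)

lemma indep_rvD:
  assumes "indep_rv S X T Y" "A \<in> sets S" "B \<in> sets T"
  shows "prob (X -` A \<inter> space M \<inter> (Y -` B \<inter> space M)) = prob (X -` A \<inter> space M) * prob (Y -` B \<inter> space M)"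
  using assms unfolding indep_rv_def by (auto intro!: indep_setD)

lemma indep_rv_measurable:
  assumes "indep_rv S X T Y"
  shows "random_variable S X" "random_variable T Y"
  using assms by (auto simp: indep_rv_def)

lemma indep_rv_sym: "indep_rv S X T Y \<Longrightarrow> indep_rv T Y S X"
  using indep_rvD[of S X T Y]
  by (intro indep_rvI) (simp_all add: indep_rv_measurable Int_commute mult.commute)

lemma indep_rv_compose:
  assumes XY: "indep_rv S X T Y" and g: "g \<in> S \<rightarrow>\<^sub>M S'" and h: "h \<in> T \<rightarrow>\<^sub>M T'"
  shows "indep_rv S' (\<lambda>\<omega>. g (X \<omega>)) T' (\<lambda>\<omega>. h (Y \<omega>))"
proof (rule indep_rvI)
  note [measurable] = indep_rv_measurable[OF XY] g h
  show "random_variable S' (\<lambda>\<omega>. g (X \<omega>))" "random_variable T' (\<lambda>\<omega>. h (Y \<omega>))" by measurable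
  fix A B assume AB: "A \<in> sets S'" "B \<in> sets T'"
  have eq: "(\<lambda>\<omega>. g (X \<omega>)) -` A \<inter> space M = X -` (g -` A \<inter> space S) \<inter> space M"
    "(\<lambda>\<omega>. h (Y \<omega>)) -` B \<inter> space M = Y -` (h -` B \<inter> space T) \<inter> space M"
    using indep_rv_measurable[OF XY, THEN measurable_space] by auto
  show "prob ((\<lambda>\<omega>. g (X \<omega>)) -` A \<inter> space M \<inter> ((\<lambda>\<omega>. h (Y \<omega>)) -` B \<inter> space M)) =
    prob ((\<lambda>\<omega>. g (X \<omega>)) -` A \<inter> space M) * prob ((\<lambda>\<omega>. h (Y \<omega>)) -` B \<inter> space M)"
    unfolding eq using AB by (intro indep_rvD[OF XY]) auto
qed

text \<open>Replacing a variable by the sigma-algebra it generates lets every quantity that is a function of the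
  variable be treated as a measurable function of \<open>\<omega>\<close>, so no factorisation through the variable is
  ever needed.\<close>
lemma indep_rv_vimage_algebra:
  assumes XY: "indep_rv S X T Y"
  shows "indep_rv (vimage_algebra (space M) X S) (\<lambda>\<omega>. \<omega>) T Y"
proof -
  have X: "X \<in> space M \<rightarrow> space S"
    using indep_rv_measurable(1)[OF XY] by (auto dest: measurable_space)
  show ?thesis
  proof (rule indep_rvI)
    show "random_variable (vimage_algebra (space M) X S) (\<lambda>\<omega>. \<omega>)"
      by (intro measurable_vimage_algebra2 indep_rv_measurable(1)[OF XY]) auto
    show "random_variable T Y" by (rule indep_rv_measurable[OF XY])
    fix A B assume "A \<in> sets (vimage_algebra (space M) X S)" and B: "B \<in> sets T"
    then obtain A' where A': "A' \<in> sets S" "A = X -` A' \<inter> space M"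
      unfolding sets_vimage_algebra2[OF X] by auto
    have "(\<lambda>\<omega>. \<omega>) -` A \<inter> space M = X -` A' \<inter> space M"
      using A' by auto
    then show "prob ((\<lambda>\<omega>. \<omega>) -` A \<inter> space M \<inter> (Y -` B \<inter> space M)) =
      prob ((\<lambda>\<omega>. \<omega>) -` A \<inter> space M) * prob (Y -` B \<inter> space M)"
      using indep_rvD[OF XY A'(1) B] by simp
  qed
qed

text \<open>Rectangles generate the events of the pair \<open>(X, Y)\<close> and are stable under intersection, so it
  suffices to multiply out the probabilities of three events.\<close>
lemma indep_rv_regroup:
  assumes XYZ: "indep_rv S X (T \<Otimes>\<^sub>M U) (\<lambda>\<omega>. (Y \<omega>, Z \<omega>))" and YZ: "indep_rv T Y U Z"
  shows "indep_rv (S \<Otimes>\<^sub>M T) (\<lambda>\<omega>. (X \<omega>, Y \<omega>)) U Z"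
proof -
  note [measurable] = indep_rv_measurable[OF YZ] indep_rv_measurable[OF XYZ]
  let ?XY = "\<lambda>\<omega>. (X \<omega>, Y \<omega>)"
  let ?R = "{?XY -` E \<inter> space M |E. E \<in> {a \<times> b |a b. a \<in> sets S \<and> b \<in> sets T}}"
  let ?U = "{Z -` C \<inter> space M |C. C \<in> sets U}"
  have XY: "?XY \<in> space M \<rightarrow> space S \<times> space T"
    using indep_rv_measurable(1)[OF YZ, THEN measurable_space]
      indep_rv_measurable(1)[OF XYZ, THEN measurable_space] by auto
  have Y: "indep_rv S X T Y"
    using indep_rv_compose[OF XYZ measurable_ident measurable_fst] by simp
  have gen: "prob (?XY -` (a \<times> b) \<inter> space M \<inter> (Z -` c \<inter> space M)) =
      prob (?XY -` (a \<times> b) \<inter> space M) * prob (Z -` c \<inter> space M)"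
    if a: "a \<in> sets S" and b: "b \<in> sets T" and c: "c \<in> sets U" for a b c
  proof -
    have "?XY -` (a \<times> b) \<inter> space M \<inter> (Z -` c \<inter> space M) =
        X -` a \<inter> space M \<inter> ((\<lambda>\<omega>. (Y \<omega>, Z \<omega>)) -` (b \<times> c) \<inter> space M)"
      by auto
    moreover have "(\<lambda>\<omega>. (Y \<omega>, Z \<omega>)) -` (b \<times> c) \<inter> space M =
        Y -` b \<inter> space M \<inter> (Z -` c \<inter> space M)" by auto
    moreover have "?XY -` (a \<times> b) \<inter> space M = X -` a \<inter> space M \<inter> (Y -` b \<inter> space M)"
      by auto
    ultimately show ?thesis
      using indep_rvD[OF XYZ a, of "b \<times> c"] indep_rvD[OF YZ b c] indep_rvD[OF Y a b] b c by simp
  qed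
  have "indep_set ?R ?U"
  proof (rule indep_setI)
    show "?R \<subseteq> events" by (auto intro!: measurable_sets[where A="S \<Otimes>\<^sub>M T"])
    show "?U \<subseteq> events" by (auto intro!: measurable_sets)
  qed (use gen in auto)
  moreover have "Int_stable ?R"
    unfolding Int_stable_def
  proof safe
    fix a b a' b' assume "a \<in> sets S" "b \<in> sets T" "a' \<in> sets S" "b' \<in> sets T"
    then show "\<exists>E. ?XY -` (a \<times> b) \<inter> space M \<inter> (?XY -` (a' \<times> b') \<inter> space M) = ?XY -` E \<inter> space M \<and>
       E \<in> {a \<times> b |a b. a \<in> sets S \<and> b \<in> sets T}"
      by (intro exI[of _ "(a \<inter> a') \<times> (b \<inter> b')"]) blast
  qed
  moreover have "Int_stable ?U"
    unfolding Int_stable_def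
  proof safe
    fix c c' assume "c \<in> sets U" "c' \<in> sets U"
    then show "\<exists>C. Z -` c \<inter> space M \<inter> (Z -` c' \<inter> space M) = Z -` C \<inter> space M \<and> C \<in> sets U"
      by (intro exI[of _ "c \<inter> c'"]) blast
  qed
  ultimately have "indep_set (sigma_sets (space M) ?R) (sigma_sets (space M) ?U)"
    by (rule indep_set_sigma_sets)
  moreover have "{?XY -` E \<inter> space M |E. E \<in> sets (S \<Otimes>\<^sub>M T)} = sigma_sets (space M) ?R"
    unfolding sets_pair_measure by (rule sigma_sets_vimage_commute[OF XY])
  ultimately show ?thesis
    by (intro indep_rvI) (auto intro!: indep_setD)
qed

text \<open>A finite set of entries meets finitely many rows; independence of the rows splits the
  probability into one factor per row, and independence within a row splits each factor further.\<close>
lemma indep_vars_flatten: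
  assumes rows: "\<And>l. indep_vars (\<lambda>_. S) (X l) UNIV"
    and array: "indep_vars (\<lambda>_. \<Pi>\<^sub>M \<alpha>\<in>UNIV. S) (\<lambda>l \<omega> \<alpha>. X l \<alpha> \<omega>) UNIV"
  shows "indep_vars (\<lambda>_. S) (\<lambda>p. X (fst p) (snd p)) UNIV"
proof -
  have [measurable]: "random_variable S (X l \<alpha>)" for l \<alpha>
    using rows[of l] by (auto simp: indep_vars_def2)
  show ?thesis
    unfolding indep_vars_def2
  proof (intro conjI ballI indep_setsI)
    fix A and J :: "('b \<times> 'c) set"
    assume J: "J \<noteq> {}" "finite J"
      and A: "\<forall>j\<in>J. A j \<in> {X (fst j) (snd j) -` B \<inter> space M |B. B \<in> sets S}"
    then obtain B where B: "\<And>j. j \<in> J \<Longrightarrow> B j \<in> sets S"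
      "\<And>j. j \<in> J \<Longrightarrow> A j = X (fst j) (snd j) -` B j \<inter> space M"
      by simp metis
    define K where "K = fst ` J"
    define R where "R l = {\<alpha>. (l, \<alpha>) \<in> J}" for l
    have K: "finite K" "K \<noteq> {}" and fR: "finite (R l)" for l
      using J finite_vimageI[of J "Pair l"] by (auto simp: K_def R_def inj_on_def vimage_def)
    have R: "R l \<noteq> {}" if "l \<in> K" for l
      using that by (auto simp: K_def R_def)
    have J_eq: "J = Sigma K R" by (force simp: K_def R_def)
    define C where "C l = {y \<in> space (\<Pi>\<^sub>M \<alpha>\<in>UNIV. S). \<forall>\<alpha>\<in>R l. y \<alpha> \<in> B (l, \<alpha>)}" for l
    \<comment> \<open>The event that the entries of row \<open>l\<close> with index in \<open>J\<close> take their values in the sets \<open>B\<close>,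
       seen as a condition on the whole row.\<close>
    have C: "C l \<in> sets (\<Pi>\<^sub>M \<alpha>\<in>UNIV. S)" for l
      unfolding C_def using fR[of l] B(1)
      by (intro sets.sets_Collect_finite_All sets_Collect_single')
        (auto simp: R_def space_PiM)
    have row: "(\<lambda>\<omega> \<alpha>. X l \<alpha> \<omega>) -` C l \<inter> space M = (\<Inter>\<alpha>\<in>R l. X l \<alpha> -` B (l, \<alpha>) \<inter> space M)"
      if "l \<in> K" for l
      using R[OF that] measurable_space[of "X l _" M S] by (auto simp: C_def space_PiM)
    have "(\<Inter>j\<in>J. A j) = (\<Inter>l\<in>K. \<Inter>\<alpha>\<in>R l. A (l, \<alpha>))"
      unfolding J_eq by auto
    also have "\<dots> = (\<Inter>l\<in>K. (\<lambda>\<omega> \<alpha>. X l \<alpha> \<omega>) -` C l \<inter> space M)"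
    proof (intro INF_cong refl)
      fix l assume l: "l \<in> K"
      have "A (l, \<alpha>) = X l \<alpha> -` B (l, \<alpha>) \<inter> space M" if "\<alpha> \<in> R l" for \<alpha>
        using B(2)[of "(l, \<alpha>)"] that by (simp add: R_def)
      then show "(\<Inter>\<alpha>\<in>R l. A (l, \<alpha>)) = (\<lambda>\<omega> \<alpha>. X l \<alpha> \<omega>) -` C l \<inter> space M"
        unfolding row[OF l] by (intro INF_cong refl)
    qed
    also have "prob \<dots> = (\<Prod>l\<in>K. prob ((\<lambda>\<omega> \<alpha>. X l \<alpha> \<omega>) -` C l \<inter> space M))"
      using K C by (intro indep_varsD[OF array]) auto
    also have "\<dots> = (\<Prod>l\<in>K. \<Prod>\<alpha>\<in>R l. prob (X l \<alpha> -` B (l, \<alpha>) \<inter> space M))"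
    proof (intro prod.cong refl)
      fix l assume l: "l \<in> K"
      show "prob ((\<lambda>\<omega> \<alpha>. X l \<alpha> \<omega>) -` C l \<inter> space M) =
        (\<Prod>\<alpha>\<in>R l. prob (X l \<alpha> -` B (l, \<alpha>) \<inter> space M))"
        unfolding row[OF l] using R[OF l] fR B(1)
        by (intro indep_varsD[OF rows]) (auto simp: R_def)
    qed
    also have "\<dots> = (\<Prod>j\<in>J. prob (A j))"
      using K fR B(2) by (simp add: J_eq prod.Sigma split_beta)
    finally show "prob (\<Inter>j\<in>J. A j) = (\<Prod>j\<in>J. prob (A j))" .
  qed (auto intro!: measurable_sets)
qed

lemma distr_Pair_indep_rv:
  assumes XY: "indep_rv S X T Y"
  shows "distr M (S \<Otimes>\<^sub>M T) (\<lambda>\<omega>. (X \<omega>, Y \<omega>)) = distr M S X \<Otimes>\<^sub>M distr M T Y"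
proof (rule pair_measure_eqI[symmetric])
  note [measurable] = indep_rv_measurable[OF XY]
  show "sigma_finite_measure (distr M S X)" "sigma_finite_measure (distr M T Y)"
    by (auto intro!: prob_space_distr prob_space_imp_sigma_finite)
  show "sets (distr M S X \<Otimes>\<^sub>M distr M T Y) = sets (distr M (S \<Otimes>\<^sub>M T) (\<lambda>\<omega>. (X \<omega>, Y \<omega>)))"
    by simp
  fix A B assume "A \<in> sets (distr M S X)" "B \<in> sets (distr M T Y)"
  then have AB: "A \<in> sets S" "B \<in> sets T" by auto
  moreover have "(\<lambda>\<omega>. (X \<omega>, Y \<omega>)) -` (A \<times> B) \<inter> space M = X -` A \<inter> space M \<inter> (Y -` B \<inter> space M)"
    by auto
  ultimately show "emeasure (distr M S X) A * emeasure (distr M T Y) B =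
      emeasure (distr M (S \<Otimes>\<^sub>M T) (\<lambda>\<omega>. (X \<omega>, Y \<omega>))) (A \<times> B)"
    using indep_rvD[OF XY AB]
    by (simp add: emeasure_distr emeasure_eq_measure ennreal_mult[symmetric])
qed

text \<open>Fubini for an independent pair: \<open>X\<close> is frozen while \<open>Y\<close> is integrated out. The main use has
  \<open>X\<close> the identity into a sub-sigma-algebra that is independent of \<open>Y\<close>.\<close>
lemma nn_integral_freeze:
  assumes XY: "indep_rv S X T Y" and h [measurable]: "h \<in> borel_measurable (S \<Otimes>\<^sub>M T)"
  shows "(\<integral>\<^sup>+\<omega>. h (X \<omega>, Y \<omega>) \<partial>M) = (\<integral>\<^sup>+\<omega>. (\<integral>\<^sup>+y. h (X \<omega>, y) \<partial>distr M T Y) \<partial>M)"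
proof -
  note [measurable] = indep_rv_measurable[OF XY]
  interpret Y: prob_space "distr M T Y" by (rule prob_space_distr) simp
  have "(\<integral>\<^sup>+\<omega>. h (X \<omega>, Y \<omega>) \<partial>M) = (\<integral>\<^sup>+z. h z \<partial>(distr M S X \<Otimes>\<^sub>M distr M T Y))"
    by (simp add: distr_Pair_indep_rv[OF XY, symmetric] nn_integral_distr)
  also have "\<dots> = (\<integral>\<^sup>+x. (\<integral>\<^sup>+y. h (x, y) \<partial>distr M T Y) \<partial>distr M S X)"
    by (rule Y.nn_integral_fst[symmetric]) simp
  also have "\<dots> = (\<integral>\<^sup>+\<omega>. (\<integral>\<^sup>+y. h (X \<omega>, y) \<partial>distr M T Y) \<partial>M)"
    by (rule nn_integral_distr) simp_all
  finally show ?thesis .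
qed

lemma integral_freeze:
  fixes h :: "_ \<Rightarrow> _::{banach, second_countable_topology}"
  assumes XY: "indep_rv S X T Y" and h [measurable]: "h \<in> borel_measurable (S \<Otimes>\<^sub>M T)"
    and int: "integrable M (\<lambda>\<omega>. h (X \<omega>, Y \<omega>))"
  shows "integrable M (\<lambda>\<omega>. \<integral>y. h (X \<omega>, y) \<partial>distr M T Y)"
    and "(\<integral>\<omega>. h (X \<omega>, Y \<omega>) \<partial>M) = (\<integral>\<omega>. (\<integral>y. h (X \<omega>, y) \<partial>distr M T Y) \<partial>M)"
proof -
  note [measurable] = indep_rv_measurable[OF XY]
  interpret X: prob_space "distr M S X" by (rule prob_space_distr) simp
  interpret Y: prob_space "distr M T Y" by (rule prob_space_distr) simp
  interpret XY: pair_sigma_finite "distr M S X" "distr M T Y" ..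
  have int': "integrable (distr M S X \<Otimes>\<^sub>M distr M T Y) h"
    using int by (simp add: distr_Pair_indep_rv[OF XY, symmetric] integrable_distr_eq)
  have meas: "(\<lambda>x. \<integral>y. h (x, y) \<partial>distr M T Y) \<in> borel_measurable S"
    by (rule Y.borel_measurable_lebesgue_integral) simp
  show "integrable M (\<lambda>\<omega>. \<integral>y. h (X \<omega>, y) \<partial>distr M T Y)"
    using XY.integrable_fst'[OF int'] meas by (simp add: integrable_distr_eq)
  have "(\<integral>\<omega>. h (X \<omega>, Y \<omega>) \<partial>M) = (\<integral>z. h z \<partial>(distr M S X \<Otimes>\<^sub>M distr M T Y))"
    by (simp add: distr_Pair_indep_rv[OF XY, symmetric] integral_distr)
  also have "\<dots> = (\<integral>x. (\<integral>y. h (x, y) \<partial>distr M T Y) \<partial>distr M S X)"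
    by (rule XY.integral_fst'[OF int', symmetric])
  also have "\<dots> = (\<integral>\<omega>. (\<integral>y. h (X \<omega>, y) \<partial>distr M T Y) \<partial>M)"
    by (rule integral_distr) (use meas in simp_all)
  finally show "(\<integral>\<omega>. h (X \<omega>, Y \<omega>) \<partial>M) = (\<integral>\<omega>. (\<integral>y. h (X \<omega>, y) \<partial>distr M T Y) \<partial>M)" .
qed

text \<open>The same freezing, localised to the events of the sub-sigma-algebra, identifies the
  conditional expectation.\<close>
lemma real_cond_exp_freeze:
  fixes h :: "_ \<Rightarrow> real"
  assumes FY: "indep_rv F (\<lambda>\<omega>. \<omega>) T Y" and F: "subalgebra M F"
    and h [measurable]: "h \<in> borel_measurable (F \<Otimes>\<^sub>M T)"
    and int: "integrable M (\<lambda>\<omega>. h (\<omega>, Y \<omega>))"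
  shows "AE \<omega> in M. real_cond_exp M F (\<lambda>\<omega>. h (\<omega>, Y \<omega>)) \<omega> = (\<integral>y. h (\<omega>, y) \<partial>distr M T Y)"
proof -
  interpret finite_measure_subalgebra M F
    by unfold_locales (rule F)
  note [measurable] = indep_rv_measurable[OF FY]
  interpret Y: prob_space "distr M T Y" by (rule prob_space_distr) simp
  show ?thesis
  proof (rule real_cond_exp_charact)
    show "integrable M (\<lambda>\<omega>. h (\<omega>, Y \<omega>))" by (rule int)
    show "integrable M (\<lambda>\<omega>. \<integral>y. h (\<omega>, y) \<partial>distr M T Y)"
      by (rule integral_freeze(1)[OF FY h int])
    show "(\<lambda>\<omega>. \<integral>y. h (\<omega>, y) \<partial>distr M T Y) \<in> borel_measurable F"
      by (rule Y.borel_measurable_lebesgue_integral) simp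
    fix A assume A [measurable]: "A \<in> sets F"
    then have "A \<in> sets M" using F by (auto simp: subalgebra_def)
    then have "integrable M (\<lambda>\<omega>. indicator A \<omega> *\<^sub>R h (\<omega>, Y \<omega>))"
      using int by (rule integrable_mult_indicator)
    then have "(\<integral>\<omega>. indicator A \<omega> *\<^sub>R h (\<omega>, Y \<omega>) \<partial>M) =
        (\<integral>\<omega>. (\<integral>y. indicator A \<omega> *\<^sub>R h (\<omega>, y) \<partial>distr M T Y) \<partial>M)"
      using integral_freeze(2)[OF FY, of "\<lambda>z. indicator A (fst z) *\<^sub>R h z"] by simp
    then show "(\<integral>\<omega>\<in>A. h (\<omega>, Y \<omega>) \<partial>M) = (\<integral>\<omega>\<in>A. (\<integral>y. h (\<omega>, y) \<partial>distr M T Y) \<partial>M)"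
      by (simp add: set_lebesgue_integral_def)
  qed
qed

text \<open>The mean minimises the mean squared distance. Stated with nonnegative integrals it holds also for
  infinite second moments, which is the form that can be applied pointwise under an outer
  integral.\<close>
lemma nn_integral_centred_le:
  fixes X :: "'a \<Rightarrow> 'b::euclidean_space"
  assumes X: "integrable M X"
  shows "(\<integral>\<^sup>+\<omega>. ennreal ((norm (X \<omega> - expectation X))\<^sup>2) \<partial>M) \<le> (\<integral>\<^sup>+\<omega>. ennreal ((norm (X \<omega>))\<^sup>2) \<partial>M)"
proof (cases "integrable M (\<lambda>\<omega>. (norm (X \<omega>))\<^sup>2)")
  case True
  let ?m = "expectation X"
  have eq: "(norm (X \<omega> - ?m))\<^sup>2 = (norm (X \<omega>))\<^sup>2 - 2 * (X \<omega> \<bullet> ?m) + (norm ?m)\<^sup>2" for \<omega>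
    by (simp add: power2_norm_eq_inner inner_diff_left inner_diff_right inner_commute)
  have int: "integrable M (\<lambda>\<omega>. (norm (X \<omega> - ?m))\<^sup>2)"
    unfolding eq using True X by simp
  have "(\<integral>\<omega>. (norm (X \<omega> - ?m))\<^sup>2 \<partial>M) = (\<integral>\<omega>. (norm (X \<omega>))\<^sup>2 \<partial>M) - (norm ?m)\<^sup>2"
    unfolding eq using True X by (simp add: prob_space power2_norm_eq_inner)
  then have "(\<integral>\<omega>. (norm (X \<omega> - ?m))\<^sup>2 \<partial>M) \<le> (\<integral>\<omega>. (norm (X \<omega>))\<^sup>2 \<partial>M)"
    by simp
  then show ?thesis
    using True int by (simp add: nn_integral_eq_integral)
next
  case False
  have "(\<integral>\<^sup>+\<omega>. ennreal ((norm (X \<omega>))\<^sup>2) \<partial>M) = \<infinity>"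
    using False X by (auto simp: integrable_iff_bounded not_less top_unique)
  then show ?thesis by simp
qed

lemma integrable_if_square_integrable:
  fixes X :: "'a \<Rightarrow> 'b::euclidean_space"
  assumes "X \<in> borel_measurable M" "integrable M (\<lambda>\<omega>. (norm (X \<omega>))\<^sup>2)"
  shows "integrable M X"
proof (rule Bochner_Integration.integrable_bound)
  show "integrable M (\<lambda>\<omega>. 1 + (norm (X \<omega>))\<^sup>2)" using assms by simp
  have "norm (X \<omega>) \<le> 1 + (norm (X \<omega>))\<^sup>2" for \<omega>
    using sum_squares_bound[of "norm (X \<omega>)" 1] zero_le_power2[of "norm (X \<omega>)"] norm_ge_zero[of "X \<omega>"]
    by (simp add: power2_eq_square del: norm_ge_zero)
  then show "AE \<omega> in M. norm (X \<omega>) \<le> norm (1 + (norm (X \<omega>))\<^sup>2)"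
    by simp
qed fact

end

section \<open>Orthogonal families\<close>

lemma integrable_inner_square_integrable:
  fixes X Y :: "'a \<Rightarrow> 'b::euclidean_space"
  assumes [measurable]: "X \<in> borel_measurable M" "Y \<in> borel_measurable M"
    and "integrable M (\<lambda>\<omega>. (norm (X \<omega>))\<^sup>2)" "integrable M (\<lambda>\<omega>. (norm (Y \<omega>))\<^sup>2)"
  shows "integrable M (\<lambda>\<omega>. X \<omega> \<bullet> Y \<omega>)"
proof (rule Bochner_Integration.integrable_bound)
  show "integrable M (\<lambda>\<omega>. (norm (X \<omega>))\<^sup>2 + (norm (Y \<omega>))\<^sup>2)" using assms by simp
  have "\<bar>X \<omega> \<bullet> Y \<omega>\<bar> \<le> (norm (X \<omega>))\<^sup>2 + (norm (Y \<omega>))\<^sup>2" for \<omega>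
    using Cauchy_Schwarz_ineq2[of "X \<omega>" "Y \<omega>"] sum_squares_bound[of "norm (X \<omega>)" "norm (Y \<omega>)"]
      mult_nonneg_nonneg[OF norm_ge_zero[of "X \<omega>"] norm_ge_zero[of "Y \<omega>"]]
    by linarith
  then show "AE \<omega> in M. norm (X \<omega> \<bullet> Y \<omega>) \<le> norm ((norm (X \<omega>))\<^sup>2 + (norm (Y \<omega>))\<^sup>2)"
    by simp
qed simp

lemma integral_norm_sum_orthogonal:
  fixes D :: "'i \<Rightarrow> 'a \<Rightarrow> 'b::euclidean_space" and c :: "'i \<Rightarrow> real"
  assumes P: "finite P"
    and D: "\<And>p. p \<in> P \<Longrightarrow> D p \<in> borel_measurable M"
    and sq: "\<And>p. p \<in> P \<Longrightarrow> integrable M (\<lambda>\<omega>. (norm (D p \<omega>))\<^sup>2)"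
    and orth: "\<And>p q. p \<in> P \<Longrightarrow> q \<in> P \<Longrightarrow> p \<noteq> q \<Longrightarrow> (\<integral>\<omega>. D p \<omega> \<bullet> D q \<omega> \<partial>M) = 0"
  shows "integrable M (\<lambda>\<omega>. (norm (\<Sum>p\<in>P. c p *\<^sub>R D p \<omega>))\<^sup>2)"
    and "(\<integral>\<omega>. (norm (\<Sum>p\<in>P. c p *\<^sub>R D p \<omega>))\<^sup>2 \<partial>M) = (\<Sum>p\<in>P. (c p)\<^sup>2 * (\<integral>\<omega>. (norm (D p \<omega>))\<^sup>2 \<partial>M))"
proof -
  have eq: "(norm (\<Sum>p\<in>P. c p *\<^sub>R D p \<omega>))\<^sup>2 = (\<Sum>p\<in>P. \<Sum>q\<in>P. c p * c q * (D p \<omega> \<bullet> D q \<omega>))" for \<omega>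
    unfolding power2_norm_eq_inner inner_sum_left
    by (intro sum.cong refl) (simp add: inner_sum_right sum_distrib_left mult.assoc mult.left_commute)
  have int: "integrable M (\<lambda>\<omega>. D p \<omega> \<bullet> D q \<omega>)" if "p \<in> P" "q \<in> P" for p q
    using that by (intro integrable_inner_square_integrable D sq)
  show "integrable M (\<lambda>\<omega>. (norm (\<Sum>p\<in>P. c p *\<^sub>R D p \<omega>))\<^sup>2)"
    unfolding eq by (intro Bochner_Integration.integrable_sum integrable_mult_right int)
  have "(\<integral>\<omega>. (norm (\<Sum>p\<in>P. c p *\<^sub>R D p \<omega>))\<^sup>2 \<partial>M) =
      (\<Sum>p\<in>P. \<Sum>q\<in>P. c p * c q * (\<integral>\<omega>. D p \<omega> \<bullet> D q \<omega> \<partial>M))"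
    unfolding eq using int by (simp add: Bochner_Integration.integral_sum)
  also have "\<dots> = (\<Sum>p\<in>P. \<Sum>q\<in>P. if q = p then (c p)\<^sup>2 * (\<integral>\<omega>. (norm (D p \<omega>))\<^sup>2 \<partial>M) else 0)"
    using orth by (intro sum.cong refl) (auto simp: power2_norm_eq_inner power2_eq_square[of "c _"])
  finally show "(\<integral>\<omega>. (norm (\<Sum>p\<in>P. c p *\<^sub>R D p \<omega>))\<^sup>2 \<partial>M) =
      (\<Sum>p\<in>P. (c p)\<^sup>2 * (\<integral>\<omega>. (norm (D p \<omega>))\<^sup>2 \<partial>M))"
    using P by simp
qed

text \<open>The sum over the level differences, abstractly: each term cancels against the subtrahend
  of its successor in \<open>A\<close>, and only the largest one survives.\<close>
lemma sum_telescope_Max: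
  fixes a :: "'i::linorder \<Rightarrow> 'b::ab_group_add"
  assumes "finite A" "A \<noteq> {}"
  shows "(\<Sum>l\<in>A. if l > Min A then a l - a (Max {l'\<in>A. l' < l}) else a l) = a (Max A)"
  using assms
proof (induction A rule: finite_linorder_max_induct)
  case (insert b A)
  show ?case
  proof (cases "A = {}")
    case False
    have Min: "Min (insert b A) = Min A"
      using insert False by (auto simp: min_def dest!: bspec[OF _ Min_in])
    have "b > Min A" using insert False by auto
    have pred: "{l'\<in>insert b A. l' < l} = {l'\<in>A. l' < l}" if "l \<in> A" for l
      using that insert by auto
    have b: "{l'\<in>insert b A. l' < b} = A" using insert by auto
    have Max: "Max (insert b A) = b"
      using insert by (intro Max_eqI) (auto intro: less_imp_le)
    have "b \<notin> A" using insert by auto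
    then show ?thesis
      unfolding Min Max
      using insert False \<open>b > Min A\<close> by (simp add: b pred cong: if_cong del: insert_iff)
  qed simp
qed simp

section \<open>The error of the estimator as a sum of deviations\<close>

context mice
begin

abbreviation sample :: "nat \<times> nat \<Rightarrow> 'w \<Rightarrow> real^'m" where
  "sample p \<equiv> \<theta> (fst p) (snd p)"

text \<open>The samples of higher levels may stay in: what matters is that this sigma-algebra is independent of
  the sample \<open>p\<close> and still determines all iterates up to the level of \<open>p\<close>.\<close>
definition others :: "nat \<times> nat \<Rightarrow> 'w measure" where
  "others p = vimage_algebra (space M) (\<lambda>\<omega>. (\<xi> 0 \<omega>, \<lambda>q\<in>-{p}. sample q \<omega>))
     (borel \<Otimes>\<^sub>M (\<Pi>\<^sub>M q\<in>-{p}. borel))"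

definition mean_diff :: "nat \<Rightarrow> nat \<Rightarrow> 'w \<Rightarrow> real^'d" where
  "mean_diff k l \<omega> = (\<integral>t. level_diff f L (\<lambda>j. \<xi> j \<omega>) l k t \<partial>\<pi>)"

definition centred_diff :: "nat \<Rightarrow> nat \<Rightarrow> 'w \<Rightarrow> real^'m \<Rightarrow> real^'d" where
  "centred_diff k l \<omega> t = level_diff f L (\<lambda>j. \<xi> j \<omega>) l k t - mean_diff k l \<omega>"

lemma L_subset: "L k \<subseteq> {..k}"
proof (induction k)
  case (Suc k)
  then show ?case using L_Suc[of k] by fastforce
qed (simp add: L_0)

lemma finite_L: "finite (L k)"
  using L_subset by (rule finite_subset) simp

lemma L_nonempty: "L k \<noteq> {}"
  using L_self by auto

lemma Max_L: "Max (L k) = k"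
  using L_subset L_self finite_L by (intro Max_eqI) auto

lemma prev_level_in_L:
  assumes "l \<in> L k" "l > Min (L k)"
  shows "prev_level L k l \<in> L k" "prev_level L k l < l"
proof -
  have "Min (L k) \<in> {l' \<in> L k. l' < l}"
    using assms finite_L L_nonempty by simp
  then have "Max {l' \<in> L k. l' < l} \<in> {l' \<in> L k. l' < l}"
    using finite_L[of k] by (intro Max_in) auto
  then show "prev_level L k l \<in> L k" "prev_level L k l < l"
    by (auto simp: prev_level_def)
qed

lemma sample_measurable [measurable]: "random_variable borel (\<theta> l \<alpha>)"
  using iid_level[of l] by (auto simp: indep_vars_def2)

lemma sets_law [measurable_cong, simp]: "sets \<pi> = sets borel"
  using sample_law[of 0 0] by (metis sets_distr)

lemma prob_space_law: "prob_space \<pi>"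
  using prob_space_distr[OF sample_measurable[of 0 0]] by (simp add: sample_law)

text \<open>All samples over all levels are independent, so one of them is independent of the family
  of the others; the initial iterate, independent of both together, is then moved to the side of
  the others.\<close>
lemma sample_indep_others: "indep_rv (others p) (\<lambda>\<omega>. \<omega>) borel (sample p)"
proof -
  have "indep_vars (\<lambda>_. borel) sample UNIV"
    by (rule indep_vars_flatten[OF iid_level indep_levels])
  then have "indep_var (\<Pi>\<^sub>M q\<in>-{p}. borel) (\<lambda>\<omega>. \<lambda>q\<in>-{p}. sample q \<omega>)
      (\<Pi>\<^sub>M q\<in>{p}. borel) (\<lambda>\<omega>. \<lambda>q\<in>{p}. sample q \<omega>)"
    by (rule indep_var_restrict) auto
  then have "indep_rv (\<Pi>\<^sub>M q\<in>-{p}. borel) (\<lambda>\<omega>. \<lambda>q\<in>-{p}. sample q \<omega>)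
      (\<Pi>\<^sub>M q\<in>{p}. borel) (\<lambda>\<omega>. \<lambda>q\<in>{p}. sample q \<omega>)"
    by (simp add: indep_rv_iff_indep_var)
  from indep_rv_compose[OF this measurable_ident measurable_component_singleton[of p]]
  have samples: "indep_rv (\<Pi>\<^sub>M q\<in>-{p}. borel) (\<lambda>\<omega>. \<lambda>q\<in>-{p}. sample q \<omega>) borel (sample p)"
    by simp
  have entry: "(\<lambda>y. y l \<alpha>) \<in> (\<Pi>\<^sub>M l\<in>UNIV. \<Pi>\<^sub>M \<alpha>\<in>UNIV. borel) \<rightarrow>\<^sub>M (borel :: (real^'m) measure)"
    for l \<alpha> :: nat
    by (rule measurable_compose[OF measurable_component_singleton[of l] measurable_component_singleton[of \<alpha>]])
      simp_all
  have "(\<lambda>y. (\<lambda>q\<in>-{p}. y (fst q) (snd q), y (fst p) (snd p)))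
      \<in> (\<Pi>\<^sub>M l\<in>UNIV. \<Pi>\<^sub>M \<alpha>\<in>UNIV. borel) \<rightarrow>\<^sub>M (\<Pi>\<^sub>M q\<in>-{p}. borel) \<Otimes>\<^sub>M (borel :: (real^'m) measure)"
    by (intro measurable_Pair measurable_restrict entry)
  from indep_rv_compose[OF indep_init measurable_ident this]
  have "indep_rv borel (\<xi> 0) ((\<Pi>\<^sub>M q\<in>-{p}. borel) \<Otimes>\<^sub>M borel)
      (\<lambda>\<omega>. (\<lambda>q\<in>-{p}. sample q \<omega>, sample p \<omega>))"
    by simp
  from indep_rv_regroup[OF this samples] show ?thesis
    unfolding others_def by (rule indep_rv_vimage_algebra)
qed

lemma xi0_measurable [measurable]: "random_variable borel (\<xi> 0)"
  by (rule indep_rv_measurable(1)[OF indep_init])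

lemma space_others [simp]: "space (others p) = space M"
  by (simp add: others_def)

lemma others_generators:
  shows "\<xi> 0 \<in> others p \<rightarrow>\<^sub>M borel"
    and "q \<noteq> p \<Longrightarrow> sample q \<in> others p \<rightarrow>\<^sub>M borel"
proof -
  let ?S = "(borel :: (real^'d) measure) \<Otimes>\<^sub>M (\<Pi>\<^sub>M q\<in>-{p}. (borel :: (real^'m) measure))"
  let ?X = "\<lambda>\<omega>. (\<xi> 0 \<omega>, \<lambda>q\<in>-{p}. sample q \<omega>)"
  have X: "?X \<in> others p \<rightarrow>\<^sub>M ?S"
    unfolding others_def by (rule measurable_vimage_algebra1) (auto simp: space_pair_measure space_PiM)
  show "\<xi> 0 \<in> others p \<rightarrow>\<^sub>M borel"
    using measurable_compose[OF X measurable_fst] by simp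
  show "sample q \<in> others p \<rightarrow>\<^sub>M borel" if "q \<noteq> p"
    using measurable_compose[OF X measurable_compose[OF measurable_snd measurable_component_singleton[of q]]]
      that by simp
qed

text \<open>By the time the iterate \<open>j\<close> is computed only levels below \<open>j\<close> have been sampled, since \<open>L i\<close>
  contains no number above \<open>i\<close>.\<close>
lemma iterate_measurable:
  assumes F: "space F = space M" and xi0: "\<xi> 0 \<in> F \<rightarrow>\<^sub>M borel"
    and samples: "\<And>q. fst q < j \<Longrightarrow> sample q \<in> F \<rightarrow>\<^sub>M borel"
  shows "\<xi> j \<in> F \<rightarrow>\<^sub>M borel"
proof (cases j)
  case (Suc i)
  obtain \<Phi> where \<Phi>: "\<Phi> \<in> (borel \<Otimes>\<^sub>M (\<Pi>\<^sub>M p\<in>used_samples L N i. borel)) \<rightarrow>\<^sub>M borel"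
    and xi: "\<And>\<omega>. \<omega> \<in> space M \<Longrightarrow>
      \<xi> (Suc i) \<omega> = \<Phi> (\<xi> 0 \<omega>, \<lambda>p\<in>used_samples L N i. \<theta> (fst p) (snd p) \<omega>)"
    using iterate_Suc[of i] by blast
  have "fst q < j" if "q \<in> used_samples L N i" for q
    using that L_subset Suc by (fastforce simp: used_samples_def)
  then have "(\<lambda>\<omega>. \<Phi> (\<xi> 0 \<omega>, \<lambda>p\<in>used_samples L N i. \<theta> (fst p) (snd p) \<omega>)) \<in> F \<rightarrow>\<^sub>M borel"
    by (intro measurable_compose[OF _ \<Phi>] measurable_Pair xi0 measurable_restrict samples)
  then show ?thesis
    by (rule measurable_cong[THEN iffD2, rotated]) (use xi F Suc in simp)
qed (simp add: xi0)

lemma iterate_measurable_others: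
  assumes "j \<le> fst p"
  shows "\<xi> j \<in> others p \<rightarrow>\<^sub>M borel"
proof (rule iterate_measurable)
  fix q :: "nat \<times> nat" assume "fst q < j"
  then show "sample q \<in> others p \<rightarrow>\<^sub>M borel"
    using assms by (intro others_generators) auto
qed (simp_all add: others_generators)

lemma iterate_random_variable [measurable]: "random_variable borel (\<xi> j)"
  by (rule iterate_measurable) simp_all

text \<open>Only iterates up to index \<open>l\<close> enter the difference of level \<open>l\<close>. This restriction
  is what allows \<open>F\<close> to be \<open>others p\<close> for a sample \<open>p\<close> of level \<open>l\<close>.\<close>
lemma level_diff_measurable:
  assumes l: "l \<in> L k" and xi: "\<And>j. j \<in> L k \<Longrightarrow> j \<le> l \<Longrightarrow> \<xi> j \<in> F \<rightarrow>\<^sub>M borel"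
  shows "(\<lambda>(\<omega>, t). level_diff f L (\<lambda>j. \<xi> j \<omega>) l k t) \<in> borel_measurable (F \<Otimes>\<^sub>M borel)"
proof -
  have grad: "(\<lambda>z. grad_f f (\<xi> j (fst z)) (snd z)) \<in> borel_measurable (F \<Otimes>\<^sub>M borel)"
    if "j \<in> L k" "j \<le> l" for j
  proof -
    note [measurable] = xi[OF that]
    have "(\<lambda>z. (\<xi> j (fst z), snd z)) \<in> F \<Otimes>\<^sub>M borel \<rightarrow>\<^sub>M borel \<Otimes>\<^sub>M borel"
      by measurable
    from measurable_compose[OF this grad_f_measurable] show ?thesis by simp
  qed
  show ?thesis
  proof (cases "l > Min (L k)")
    case True
    then have "(\<lambda>(\<omega>, t). level_diff f L (\<lambda>j. \<xi> j \<omega>) l k t) =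
        (\<lambda>z. grad_f f (\<xi> l (fst z)) (snd z) - grad_f f (\<xi> (prev_level L k l) (fst z)) (snd z))"
      by (simp add: level_diff_def split_beta')
    then show ?thesis
      using prev_level_in_L[OF l True] l by (simp add: borel_measurable_diff grad)
  next
    case False
    then show ?thesis
      using grad[OF l order_refl] by (simp add: level_diff_def split_beta')
  qed
qed

lemma mean_diff_measurable:
  assumes "l \<in> L k" and "\<And>j. j \<in> L k \<Longrightarrow> j \<le> l \<Longrightarrow> \<xi> j \<in> F \<rightarrow>\<^sub>M borel"
  shows "mean_diff k l \<in> borel_measurable F"
proof -
  interpret law: prob_space \<pi> by (rule prob_space_law)
  show ?thesis
    unfolding mean_diff_def
    using level_diff_measurable[OF assms] by (intro law.borel_measurable_lebesgue_integral) simp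
qed

lemma centred_diff_measurable:
  assumes "l \<in> L k" and "\<And>j. j \<in> L k \<Longrightarrow> j \<le> l \<Longrightarrow> \<xi> j \<in> F \<rightarrow>\<^sub>M borel"
  shows "(\<lambda>z. centred_diff k l (fst z) (snd z)) \<in> borel_measurable (F \<Otimes>\<^sub>M borel)"
  using level_diff_measurable[OF assms] measurable_compose[OF measurable_fst mean_diff_measurable[OF assms]]
  unfolding centred_diff_def split_beta by (rule borel_measurable_diff)

lemma level_diff_integrable: "integrable \<pi> (level_diff f L x l k)"
  unfolding level_diff_def using grad_f_integrable by (cases "l > Min (L k)") auto

lemma centred_diff_integrable: "integrable \<pi> (centred_diff k l \<omega>)"
  and integral_centred_diff: "(\<integral>t. centred_diff k l \<omega> t \<partial>\<pi>) = 0"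
proof -
  interpret law: prob_space \<pi> by (rule prob_space_law)
  show "integrable \<pi> (centred_diff k l \<omega>)"
    unfolding centred_diff_def using level_diff_integrable by simp
  show "(\<integral>t. centred_diff k l \<omega> t \<partial>\<pi>) = 0"
    unfolding centred_diff_def using level_diff_integrable
    by (simp add: law.prob_space mean_diff_def)
qed

text \<open>The mean of a level difference is a difference of gradients of the objective, and the largest level
  is \<open>k\<close>, so the sum telescopes.\<close>
lemma sum_mean_diff: "(\<Sum>l\<in>L k. mean_diff k l \<omega>) = gradient (objective f \<pi>) (\<xi> k \<omega>)"
proof -
  let ?g = "\<lambda>j. gradient (objective f \<pi>) (\<xi> j \<omega>)"
  have "mean_diff k l \<omega> =
      (if l > Min (L k) then ?g l - ?g (Max {l' \<in> L k. l' < l}) else ?g l)" for l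
    using grad_f_integrable by (simp add: mean_diff_def level_diff_def gradient_objective prev_level_def)
  then show ?thesis
    using sum_telescope_Max[OF finite_L L_nonempty, where a = ?g] by (simp add: Max_L)
qed

lemma estimator_error:
  "mice_estimator f L N \<theta> \<xi> k \<omega> - gradient (objective f \<pi>) (\<xi> k \<omega>) =
    (\<Sum>p\<in>(SIGMA l:L k. {..<N l k}). (1 / real (N (fst p) k)) *\<^sub>R centred_diff k (fst p) \<omega> (sample p \<omega>))"
proof -
  have level: "(1 / real (N l k)) *\<^sub>R (\<Sum>\<alpha><N l k. level_diff f L (\<lambda>j. \<xi> j \<omega>) l k (\<theta> l \<alpha> \<omega>)) =
      (\<Sum>\<alpha><N l k. (1 / real (N l k)) *\<^sub>R centred_diff k l \<omega> (\<theta> l \<alpha> \<omega>)) + mean_diff k l \<omega>"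
    if "l \<in> L k" for l
  proof -
    have "level_diff f L (\<lambda>j. \<xi> j \<omega>) l k t = centred_diff k l \<omega> t + mean_diff k l \<omega>" for t
      by (simp add: centred_diff_def)
    then show ?thesis
      using N_pos[OF that]
      by (simp add: sum.distrib scaleR_add_right scaleR_sum_right sum_constant_scaleR del: sum_constant)
  qed
  have "mice_estimator f L N \<theta> \<xi> k \<omega> =
      (\<Sum>l\<in>L k. \<Sum>\<alpha><N l k. (1 / real (N l k)) *\<^sub>R centred_diff k l \<omega> (\<theta> l \<alpha> \<omega>))
      + gradient (objective f \<pi>) (\<xi> k \<omega>)"
    unfolding mice_estimator_def sum_mean_diff[symmetric] sum.distrib[symmetric]
    by (intro sum.cong refl level)
  then show ?thesis
    using finite_L by (simp add: sum.Sigma split_beta)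
qed

section \<open>Orthogonality of the deviations\<close>

text \<open>The right-hand side does not mention \<open>T\<close>: the second moment is the same for every variable with
  law \<open>\<pi>\<close> that is independent of the iterates involved.\<close>
lemma nn_integral_centred_diff:
  assumes indep: "indep_rv F (\<lambda>\<omega>. \<omega>) borel T" and law: "distr M borel T = \<pi>"
    and l: "l \<in> L k" and xi: "\<And>j. j \<in> L k \<Longrightarrow> j \<le> l \<Longrightarrow> \<xi> j \<in> F \<rightarrow>\<^sub>M borel"
  shows "(\<integral>\<^sup>+\<omega>. ennreal ((norm (centred_diff k l \<omega> (T \<omega>)))\<^sup>2) \<partial>M) =
    (\<integral>\<^sup>+\<omega>. (\<integral>\<^sup>+t. ennreal ((norm (centred_diff k l \<omega> t))\<^sup>2) \<partial>\<pi>) \<partial>M)"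
proof -
  note [measurable] = centred_diff_measurable[OF l xi]
  show ?thesis
    using nn_integral_freeze[OF indep, of "\<lambda>z. ennreal ((norm (centred_diff k l (fst z) (snd z)))\<^sup>2)"]
    by (simp add: law)
qed

text \<open>Since \<open>q\<close> has at most the level of \<open>p\<close> and differs from \<open>p\<close>, its deviation is
  determined by \<open>others p\<close>. Integrating out the sample \<open>p\<close> first therefore leaves the inner
  product of that deviation with the mean of a centred variable.\<close>
lemma centred_diff_sample_orthogonal:
  assumes p: "fst p \<in> L k" and q: "fst q \<in> L k" and pq: "p \<noteq> q" "fst q \<le> fst p"
    and sq: "\<And>r. fst r \<in> L k \<Longrightarrow> integrable M (\<lambda>\<omega>. (norm (centred_diff k (fst r) \<omega> (sample r \<omega>)))\<^sup>2)"
  shows "(\<integral>\<omega>. centred_diff k (fst p) \<omega> (sample p \<omega>) \<bullet> centred_diff k (fst q) \<omega> (sample q \<omega>) \<partial>M) = 0"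
proof -
  let ?D = "\<lambda>r \<omega>. centred_diff k (fst r) \<omega> (sample r \<omega>)"
  have D [measurable]: "random_variable borel (?D r)" if "fst r \<in> L k" for r
    using measurable_compose[OF measurable_Pair[OF measurable_ident sample_measurable]
        centred_diff_measurable[OF that iterate_random_variable]] by simp
  have xi: "\<xi> j \<in> others p \<rightarrow>\<^sub>M borel" if "j \<le> fst p" for j
    using that by (rule iterate_measurable_others)
  have Dq [measurable]: "?D q \<in> borel_measurable (others p)"
    using measurable_compose[OF measurable_Pair[OF measurable_ident others_generators(2)]
        centred_diff_measurable[OF q]] pq xi by simp
  note [measurable] = centred_diff_measurable[OF p xi]
  let ?h = "\<lambda>z. centred_diff k (fst p) (fst z) (snd z) \<bullet> ?D q (fst z)"
  have "integrable M (\<lambda>\<omega>. ?D p \<omega> \<bullet> ?D q \<omega>)"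
    using p q by (intro integrable_inner_square_integrable D sq)
  then have "(\<integral>\<omega>. ?D p \<omega> \<bullet> ?D q \<omega> \<partial>M) = (\<integral>\<omega>. (\<integral>t. centred_diff k (fst p) \<omega> t \<bullet> ?D q \<omega> \<partial>\<pi>) \<partial>M)"
    using integral_freeze(2)[OF sample_indep_others, of ?h p] by (simp add: sample_law)
  also have "\<dots> = 0"
    using centred_diff_integrable by (simp add: integral_centred_diff)
  finally show ?thesis .
qed

section \<open>Comparison with the conditional variances\<close>

lemma iterates_algebra_measurable:
  assumes "j \<in> L k"
  shows "\<xi> j \<in> iterates_algebra M L \<xi> k \<rightarrow>\<^sub>M borel"
proof -
  have "(\<lambda>\<omega>. \<lambda>j\<in>L k. \<xi> j \<omega>) \<in> iterates_algebra M L \<xi> k \<rightarrow>\<^sub>M (\<Pi>\<^sub>M j\<in>L k. borel)"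
    unfolding iterates_algebra_def by (rule measurable_vimage_algebra1) (auto simp: space_PiM)
  from measurable_compose[OF this measurable_component_singleton[OF assms]] assms show ?thesis
    by simp
qed

lemma subalgebra_iterates_algebra: "subalgebra M (iterates_algebra M L \<xi> k)"
proof -
  have "(\<lambda>\<omega>. \<lambda>j\<in>L k. \<xi> j \<omega>) \<in> M \<rightarrow>\<^sub>M (\<Pi>\<^sub>M j\<in>L k. borel)"
    by (intro measurable_restrict iterate_random_variable)
  then have "sets (iterates_algebra M L \<xi> k) \<subseteq> sets M"
    unfolding iterates_algebra_def by (rule sets_image_in_sets[OF refl])
  then show ?thesis
    by (simp add: subalgebra_def iterates_algebra_def)
qed

lemma centred_diff_random_variable:
  assumes "l \<in> L k" "random_variable borel T"
  shows "random_variable borel (\<lambda>\<omega>. centred_diff k l \<omega> (T \<omega>))"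
  using measurable_compose[OF measurable_Pair[OF measurable_ident assms(2)]
      centred_diff_measurable[OF assms(1) iterate_random_variable]] by simp

context
  fixes \<tau> :: "'w \<Rightarrow> real^'m" and k :: nat
  assumes law: "distr M borel \<tau> = \<pi>"
    and indep: "indep_rv borel \<tau> (\<Pi>\<^sub>M j\<in>L k. borel) (\<lambda>\<omega>. \<lambda>j\<in>L k. \<xi> j \<omega>)"
    and grad_sq: "\<And>l. l \<in> L k \<Longrightarrow> integrable M (\<lambda>\<omega>. (norm (grad_f f (\<xi> l \<omega>) (\<tau> \<omega>)))\<^sup>2)"
begin

abbreviation iterates_alg :: "'w measure" where
  "iterates_alg \<equiv> iterates_algebra M L \<xi> k"

abbreviation generic_diff :: "nat \<Rightarrow> 'w \<Rightarrow> real^'d" where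
  "generic_diff l \<omega> \<equiv> level_diff f L (\<lambda>j. \<xi> j \<omega>) l k (\<tau> \<omega>)"

abbreviation generic_dev :: "nat \<Rightarrow> 'w \<Rightarrow> real^'d" where
  "generic_dev l \<omega> \<equiv> centred_diff k l \<omega> (\<tau> \<omega>)"

abbreviation sample_dev :: "nat \<times> nat \<Rightarrow> 'w \<Rightarrow> real^'d" where
  "sample_dev p \<omega> \<equiv> centred_diff k (fst p) \<omega> (sample p \<omega>)"

lemma generic_sample_indep: "indep_rv iterates_alg (\<lambda>\<omega>. \<omega>) borel \<tau>"
  unfolding iterates_algebra_def by (rule indep_rv_vimage_algebra[OF indep_rv_sym[OF indep]])

lemma generic_sample_measurable [measurable]: "random_variable borel \<tau>"
  by (rule indep_rv_measurable(1)[OF indep])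

lemma level_diff_random_variable:
  assumes "l \<in> L k"
  shows "random_variable borel (generic_diff l)"
  using measurable_compose[OF measurable_Pair[OF measurable_ident generic_sample_measurable]
      level_diff_measurable[OF assms iterate_random_variable]] by simp

lemma level_diff_square_integrable:
  assumes l: "l \<in> L k"
  shows "integrable M (\<lambda>\<omega>. (norm (generic_diff l \<omega>))\<^sup>2)"
proof (cases "l > Min (L k)")
  case True
  have bound: "(norm (a - b))\<^sup>2 \<le> 2 * (norm a)\<^sup>2 + 2 * (norm b)\<^sup>2" for a b :: "real^'d"
    using zero_le_power2[of "norm (a + b)"]
    unfolding power2_norm_eq_inner by (simp add: algebra_simps inner_commute)
  show ?thesis
  proof (rule Bochner_Integration.integrable_bound)
    show "integrable M (\<lambda>\<omega>. 2 * (norm (grad_f f (\<xi> l \<omega>) (\<tau> \<omega>)))\<^sup>2 +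
        2 * (norm (grad_f f (\<xi> (prev_level L k l) \<omega>) (\<tau> \<omega>)))\<^sup>2)"
      using grad_sq[OF l] grad_sq[OF prev_level_in_L(1)[OF l True]] by simp
    show "AE \<omega> in M. norm ((norm (generic_diff l \<omega>))\<^sup>2) \<le> norm (2 * (norm (grad_f f (\<xi> l \<omega>) (\<tau> \<omega>)))\<^sup>2 +
        2 * (norm (grad_f f (\<xi> (prev_level L k l) \<omega>) (\<tau> \<omega>)))\<^sup>2)"
      using True bound by (intro AE_I2) (simp add: level_diff_def)
    show "random_variable borel (\<lambda>\<omega>. (norm (generic_diff l \<omega>))\<^sup>2)"
      using level_diff_random_variable[OF l] by simp
  qed
next
  case False
  then show ?thesis using grad_sq[OF l] by (simp add: level_diff_def)
qed

text \<open>Freezing the iterates turns this into the comparison of a variance with a second moment, for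
  each fixed trajectory.\<close>
lemma centred_diff_square_integrable:
  assumes l: "l \<in> L k"
  shows "integrable M (\<lambda>\<omega>. (norm (generic_dev l \<omega>))\<^sup>2)"
proof -
  interpret law: prob_space \<pi> by (rule prob_space_law)
  note [measurable] = level_diff_measurable[OF l iterates_algebra_measurable]
    centred_diff_random_variable[OF l generic_sample_measurable]
  have "(\<integral>\<^sup>+\<omega>. ennreal ((norm (generic_dev l \<omega>))\<^sup>2) \<partial>M) =
      (\<integral>\<^sup>+\<omega>. (\<integral>\<^sup>+t. ennreal ((norm (centred_diff k l \<omega> t))\<^sup>2) \<partial>\<pi>) \<partial>M)"
    by (rule nn_integral_centred_diff[OF generic_sample_indep law l iterates_algebra_measurable])
  also have "\<dots> \<le> (\<integral>\<^sup>+\<omega>. (\<integral>\<^sup>+t. ennreal ((norm (level_diff f L (\<lambda>j. \<xi> j \<omega>) l k t))\<^sup>2) \<partial>\<pi>) \<partial>M)"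
    unfolding centred_diff_def mean_diff_def
    by (intro nn_integral_mono law.nn_integral_centred_le level_diff_integrable)
  also have "\<dots> = (\<integral>\<^sup>+\<omega>. ennreal ((norm (generic_diff l \<omega>))\<^sup>2) \<partial>M)"
    using nn_integral_freeze[OF generic_sample_indep,
        of "\<lambda>(\<omega>, t). ennreal ((norm (level_diff f L (\<lambda>j. \<xi> j \<omega>) l k t))\<^sup>2)"]
    by (simp add: law)
  also have "\<dots> < \<infinity>"
    using level_diff_square_integrable[OF l] by (simp add: integrable_iff_bounded)
  finally show ?thesis
    by (intro integrableI_bounded) simp_all
qed

text \<open>A sample of the estimator is in general not independent of all iterates with index in \<open>L k\<close>, but it
  is independent of those that enter its own level difference, and this gives it the second moment
  of the generic sample.\<close>
lemma sample_second_moment: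
  assumes p: "fst p \<in> L k"
  shows "integrable M (\<lambda>\<omega>. (norm (sample_dev p \<omega>))\<^sup>2)"
    and "(\<integral>\<omega>. (norm (sample_dev p \<omega>))\<^sup>2 \<partial>M) = (\<integral>\<omega>. (norm (generic_dev (fst p) \<omega>))\<^sup>2 \<partial>M)"
proof -
  note [measurable] = centred_diff_random_variable[OF p generic_sample_measurable]
    centred_diff_random_variable[OF p sample_measurable]
  have eq: "(\<integral>\<^sup>+\<omega>. ennreal ((norm (sample_dev p \<omega>))\<^sup>2) \<partial>M) = (\<integral>\<^sup>+\<omega>. ennreal ((norm (generic_dev (fst p) \<omega>))\<^sup>2) \<partial>M)"
    using nn_integral_centred_diff[OF sample_indep_others sample_law p iterate_measurable_others]
      nn_integral_centred_diff[OF generic_sample_indep law p iterates_algebra_measurable] by simp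
  show "integrable M (\<lambda>\<omega>. (norm (sample_dev p \<omega>))\<^sup>2)"
    using centred_diff_square_integrable[OF p] eq by (simp add: integrable_iff_bounded)
  show "(\<integral>\<omega>. (norm (sample_dev p \<omega>))\<^sup>2 \<partial>M) = (\<integral>\<omega>. (norm (generic_dev (fst p) \<omega>))\<^sup>2 \<partial>M)"
    using eq by (simp add: integral_eq_nn_integral)
qed

lemma sample_orthogonal:
  assumes "fst p \<in> L k" "fst q \<in> L k" "p \<noteq> q"
  shows "(\<integral>\<omega>. sample_dev p \<omega> \<bullet> sample_dev q \<omega> \<partial>M) = 0"
proof (cases "fst q \<le> fst p")
  case True
  then show ?thesis
    using assms sample_second_moment(1) by (intro centred_diff_sample_orthogonal)
next
  case False
  then have "(\<integral>\<omega>. sample_dev q \<omega> \<bullet> sample_dev p \<omega> \<partial>M) = 0"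
    using assms sample_second_moment(1) by (intro centred_diff_sample_orthogonal) auto
  then show ?thesis by (simp add: inner_commute)
qed

text \<open>Here the generic sample is needed: being independent of all the iterates, it can be integrated
  out conditionally on them.\<close>
lemma cond_exp_level_diff:
  assumes l: "l \<in> L k"
  shows "AE \<omega> in M. real_cond_exp M iterates_alg (\<lambda>\<omega>. generic_diff l \<omega> $ i) \<omega> = mean_diff k l \<omega> $ i"
proof -
  let ?h = "\<lambda>z. level_diff f L (\<lambda>j. \<xi> j (fst z)) l k (snd z) $ i"
  have h: "?h \<in> borel_measurable (iterates_alg \<Otimes>\<^sub>M borel)"
    using measurable_compose[OF level_diff_measurable[OF l iterates_algebra_measurable] borel_measurable_nth[of i]]
    by (simp add: split_beta)
  have "integrable M (generic_diff l)"
    by (rule integrable_if_square_integrable[OF level_diff_random_variable[OF l] level_diff_square_integrable[OF l]])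
  then have int: "integrable M (\<lambda>\<omega>. ?h (\<omega>, \<tau> \<omega>))"
    using integrable_bounded_linear[OF bounded_linear_vec_nth, of M "generic_diff l" i] by simp
  have "(\<integral>t. ?h (\<omega>, t) \<partial>\<pi>) = mean_diff k l \<omega> $ i" for \<omega>
    using integral_bounded_linear[OF bounded_linear_vec_nth level_diff_integrable]
    by (simp add: mean_diff_def)
  then show ?thesis
    using real_cond_exp_freeze[OF generic_sample_indep subalgebra_iterates_algebra h int]
    by (simp add: law)
qed

lemma integral_level_var:
  assumes l: "l \<in> L k"
  shows "integrable M (level_var M f L \<xi> \<tau> l k)"
    and "(\<integral>\<omega>. level_var M f L \<xi> \<tau> l k \<omega> \<partial>M) = (\<integral>\<omega>. (norm (generic_dev l \<omega>))\<^sup>2 \<partial>M)"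
proof -
  interpret iterates: finite_measure_subalgebra M iterates_alg
    by unfold_locales (rule subalgebra_iterates_algebra)
  let ?R = "\<lambda>i \<omega>. (generic_diff l \<omega> $ i - real_cond_exp M iterates_alg (\<lambda>\<omega>. generic_diff l \<omega> $ i) \<omega>)\<^sup>2"
  have R_meas: "random_variable borel (?R i)" for i
    using measurable_compose[OF level_diff_random_variable[OF l] borel_measurable_nth[of i]] by simp
  have dev_int: "integrable M (\<lambda>\<omega>. (generic_dev l \<omega> $ i)\<^sup>2)" for i
  proof (rule Bochner_Integration.integrable_bound[OF centred_diff_square_integrable[OF l]])
    show "random_variable borel (\<lambda>\<omega>. (generic_dev l \<omega> $ i)\<^sup>2)"
      using measurable_compose[OF centred_diff_random_variable[OF l generic_sample_measurable]
          borel_measurable_nth[of i]] by simp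
    have "(x $ i)\<^sup>2 \<le> (norm x)\<^sup>2" for x :: "real^'d"
      using component_le_norm_cart[of x i] power_mono[of "\<bar>x $ i\<bar>" "norm x" 2] by simp
    then show "AE \<omega> in M. norm ((generic_dev l \<omega> $ i)\<^sup>2) \<le> norm ((norm (generic_dev l \<omega>))\<^sup>2)"
      by (intro AE_I2) simp
  qed
  have AE: "AE \<omega> in M. ?R i \<omega> = (generic_dev l \<omega> $ i)\<^sup>2" for i
    using cond_exp_level_diff[OF l, of i] by eventually_elim (simp add: centred_diff_def)
  have R_int: "integrable M (?R i)" for i
    using dev_int[of i] integrable_cong_AE[OF R_meas borel_measurable_integrable[OF dev_int] AE] by simp
  have R_eq: "(\<integral>\<omega>. ?R i \<omega> \<partial>M) = (\<integral>\<omega>. (generic_dev l \<omega> $ i)\<^sup>2 \<partial>M)" for i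
    by (rule integral_cong_AE[OF R_meas borel_measurable_integrable[OF dev_int] AE])
  show "integrable M (level_var M f L \<xi> \<tau> l k)"
    unfolding level_var_def real_cond_var_def
    by (intro Bochner_Integration.integrable_sum iterates.real_cond_exp_int(1) R_int)
  have "(\<integral>\<omega>. level_var M f L \<xi> \<tau> l k \<omega> \<partial>M) = (\<Sum>i\<in>UNIV. \<integral>\<omega>. real_cond_exp M iterates_alg (?R i) \<omega> \<partial>M)"
    unfolding level_var_def real_cond_var_def
    by (intro Bochner_Integration.integral_sum iterates.real_cond_exp_int(1) R_int)
  also have "\<dots> = (\<Sum>i\<in>UNIV. \<integral>\<omega>. (generic_dev l \<omega> $ i)\<^sup>2 \<partial>M)"
    by (simp only: iterates.real_cond_exp_int(2)[OF R_int] R_eq)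
  also have "\<dots> = (\<integral>\<omega>. (\<Sum>i\<in>UNIV. (generic_dev l \<omega> $ i)\<^sup>2) \<partial>M)"
    by (intro Bochner_Integration.integral_sum[symmetric] dev_int)
  also have "\<dots> = (\<integral>\<omega>. (norm (generic_dev l \<omega>))\<^sup>2 \<partial>M)"
    by (simp add: norm_vec_def L2_set_def sum_nonneg)
  finally show "(\<integral>\<omega>. level_var M f L \<xi> \<tau> l k \<omega> \<partial>M) = (\<integral>\<omega>. (norm (generic_dev l \<omega>))\<^sup>2 \<partial>M)" .
qed

lemma integral_sq_error:
  "(\<integral>\<omega>. mice_sq_error M \<pi> f L N \<theta> \<xi> k \<omega> \<partial>M) =
   (\<integral>\<omega>. (\<Sum>l\<in>L k. level_var M f L \<xi> \<tau> l k \<omega> / real (N l k)) \<partial>M)"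
proof -
  interpret iterates: finite_measure_subalgebra M iterates_alg
    by unfold_locales (rule subalgebra_iterates_algebra)
  let ?P = "SIGMA l:L k. {..<N l k}"
  let ?c = "\<lambda>p. 1 / real (N (fst p) k)"
  have P: "finite ?P" using finite_L by auto
  have PL: "fst p \<in> L k" if "p \<in> ?P" for p using that by auto
  have dev_meas: "random_variable borel (sample_dev p)" if "p \<in> ?P" for p
    by (rule centred_diff_random_variable[OF PL[OF that] sample_measurable])
  note orth_sum = integral_norm_sum_orthogonal[OF P, of sample_dev M ?c,
      OF dev_meas sample_second_moment(1)[OF PL] sample_orthogonal[OF PL PL]]
  have "(\<integral>\<omega>. mice_sq_error M \<pi> f L N \<theta> \<xi> k \<omega> \<partial>M) = (\<integral>\<omega>. (norm (\<Sum>p\<in>?P. ?c p *\<^sub>R sample_dev p \<omega>))\<^sup>2 \<partial>M)"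
    unfolding mice_sq_error_def estimator_error
    by (rule iterates.real_cond_exp_int(2)[OF orth_sum(1)])
  also have "\<dots> = (\<Sum>p\<in>?P. (?c p)\<^sup>2 * (\<integral>\<omega>. (norm (sample_dev p \<omega>))\<^sup>2 \<partial>M))"
    by (rule orth_sum(2))
  also have "\<dots> = (\<Sum>p\<in>?P. (?c p)\<^sup>2 * (\<integral>\<omega>. (norm (generic_dev (fst p) \<omega>))\<^sup>2 \<partial>M))"
    by (intro sum.cong refl arg_cong2[where f="(*)"] sample_second_moment(2) PL)
  also have "\<dots> = (\<Sum>l\<in>L k. \<Sum>\<alpha><N l k. (1 / real (N l k))\<^sup>2 * (\<integral>\<omega>. (norm (generic_dev l \<omega>))\<^sup>2 \<partial>M))"
    using finite_L by (subst sum.Sigma) (auto simp: split_beta)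
  also have "\<dots> = (\<Sum>l\<in>L k. (\<integral>\<omega>. (norm (generic_dev l \<omega>))\<^sup>2 \<partial>M) / real (N l k))"
    by (intro sum.cong refl) (simp add: power2_eq_square)
  also have "\<dots> = (\<Sum>l\<in>L k. (\<integral>\<omega>. level_var M f L \<xi> \<tau> l k \<omega> / real (N l k) \<partial>M))"
    by (intro sum.cong refl) (simp add: integral_level_var)
  also have "\<dots> = (\<integral>\<omega>. (\<Sum>l\<in>L k. level_var M f L \<xi> \<tau> l k \<omega> / real (N l k)) \<partial>M)"
    by (intro Bochner_Integration.integral_sum[symmetric] integrable_divide integral_level_var(1))
  finally show ?thesis .
qed

end

end

theorem lemma2:
  fixes M :: "'w measure"
    and \<pi> :: "(real^'m) measure"
    and f :: "real^'d \<Rightarrow> real^'m \<Rightarrow> real"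
    and L :: "nat \<Rightarrow> nat set"
    and N :: "nat \<Rightarrow> nat \<Rightarrow> nat"
    and \<theta> :: "nat \<Rightarrow> nat \<Rightarrow> 'w \<Rightarrow> real^'m"
    and \<xi> :: "nat \<Rightarrow> 'w \<Rightarrow> real^'d"
    and \<tau> :: "'w \<Rightarrow> real^'m"
    and k :: nat
  assumes "mice M \<pi> f L N \<theta> \<xi>"
    and "distr M borel \<tau> = \<pi>"
    and "prob_space.indep_rv M borel \<tau> (\<Pi>\<^sub>M j\<in>L k. borel) (\<lambda>\<omega>. \<lambda>j\<in>L k. \<xi> j \<omega>)"
    and "\<And>l. l \<in> L k \<Longrightarrow> integrable M (\<lambda>\<omega>. (norm (grad_f f (\<xi> l \<omega>) (\<tau> \<omega>)))\<^sup>2)"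
  shows "(\<integral>\<omega>. mice_sq_error M \<pi> f L N \<theta> \<xi> k \<omega> \<partial>M) =
         (\<integral>\<omega>. (\<Sum>l\<in>L k. level_var M f L \<xi> \<tau> l k \<omega> / real (N l k)) \<partial>M)"
  by (rule mice.integral_sq_error[OF assms(1-3)]) (rule assms(4))

end
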